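(* The set $A_n=\{\langle 1,k,m\rangle: 1\le k\le m\le n-1\}$ is a minimal generating set for the semigroup $SUT_n$, and $$\mathrm{rank}(SUT_n)=|A_n|=\tfrac12 n(n-1).$$ Moreover, every $x\in SUT_n$ is a power of an element of $A_n$: $\mathbf{0}=\langle 1,1,1\rangle^2$, and $x=\langle 1,k,m+d-1\rangle^d$ for every $x=\langle d,k,m\rangle\in SUT_n\setminus\{\mathbf{0}\}$.
   Context: Fix an integer $n\ge 2$. For integers $d,k,m$ with $1-\min(0,d)\le k\le m\le n-\max(0,d)$, let $\langle d,k,m\rangle$ denote the $n\times n$ matrix with entries $x_{ij}$ ($i,j\in\{1,\dots,n\}$) equal to $1$ if $k\le i\le m$ and $j-i=d$, and $0$ otherwise. Let $\mathbf{0}$ be the $n\times n$ zero matrix and $SUT_n=\{\mathbf{0}\}\cup\{\langle d,k,m\rangle: d,k,m\in\mathbb{N},\ k\le m\le n-d\}$, a semigroup under matrix multiplication. A subset $A$ generates a finite semigroup $S$ if every element of $S$ is a finite product of elements of $A$; $A$ is a minimal generating set if no proper subset of $A$ generates $S$; and $\mathrm{rank}(S)=\min\{|A|: A\subseteq S \text{ generates } S\}$. *)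

theory Defs
  imports "Jordan_Normal_Form.Matrix"
begin

definition generates :: "('a \<Rightarrow> 'a \<Rightarrow> 'a) \<Rightarrow> 'a set \<Rightarrow> 'a set \<Rightarrow> bool" where
  "generates f S A \<longleftrightarrow>
     A \<subseteq> S \<and> (\<forall>x\<in>S. \<exists>a as. set (a # as) \<subseteq> A \<and> x = foldl f a as)"

definition minimal_generating_set :: "('a \<Rightarrow> 'a \<Rightarrow> 'a) \<Rightarrow> 'a set \<Rightarrow> 'a set \<Rightarrow> bool" where
  "minimal_generating_set f S A \<longleftrightarrow>
     generates f S A \<and> (\<forall>B. B \<subset> A \<longrightarrow> \<not> generates f S B)"

(* Intended for finite S; the finiteness of A only matters because card is 0 on infinite sets. *)
definition semigroup_rank :: "('a \<Rightarrow> 'a \<Rightarrow> 'a) \<Rightarrow> 'a set \<Rightarrow> nat" where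
  "semigroup_rank f S = (LEAST r. \<exists>A. finite A \<and> generates f S A \<and> card A = r)"

(* Matrices are indexed from 0 in the library, so row i and column j below are row i + 1 and
   column j + 1 in the usual numbering by 1, ..., n; k and m refer to the latter.
   The matrix is meant for 1 - min 0 d \<le> k, k \<le> m and m \<le> n - max 0 d. *)
definition bracket :: "nat \<Rightarrow> int \<Rightarrow> int \<Rightarrow> int \<Rightarrow> 'a::semiring_1 mat" where
  "bracket n d k m =
     mat n n (\<lambda>(i, j). if k \<le> int i + 1 \<and> int i + 1 \<le> m \<and> (int j + 1) - (int i + 1) = d
                       then 1 else 0)"

definition SUT :: "nat \<Rightarrow> 'a::semiring_1 mat set" where
  "SUT n = {0\<^sub>m n n} \<union> {bracket n d k m | d k m. 1 \<le> d \<and> 1 \<le> k \<and> k \<le> m \<and> m \<le> int n - d}"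

definition SUT_gens :: "nat \<Rightarrow> 'a::semiring_1 mat set" where
  "SUT_gens n = {bracket n 1 k m | k m. 1 \<le> k \<and> k \<le> m \<and> m \<le> int n - 1}"

lemma bracket_mult:
  assumes "0 \<le> d" "m \<le> int n - d"
  shows "bracket n d k m * bracket n d' k' m' =
    (bracket n (d + d') (max k (k' - d)) (min m (m' - d)) :: 'a::semiring_1 mat)"
    (is "?X * ?Y = ?Z")
proof (rule eq_matI)
  fix i j assume "i < dim_row ?Z" "j < dim_col ?Z"
  then have i: "i < n" and j: "j < n" by (auto simp: bracket_def)
  have "(?X * ?Y) $$ (i, j) = (\<Sum>l = 0..<n. ?X $$ (i, l) * ?Y $$ (l, j))"
    using i j by (simp add: bracket_def scalar_prod_def)
  also have "\<dots> = (\<Sum>l = 0..<n. if l = i + nat d then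
      (if k \<le> int i + 1 \<and> int i + 1 \<le> m then ?Y $$ (l, j) else 0) else 0)"
    using i assms by (intro sum.cong) (auto simp: bracket_def)
  also have "\<dots> = (if i + nat d < n then
      (if k \<le> int i + 1 \<and> int i + 1 \<le> m then ?Y $$ (i + nat d, j) else 0) else 0)"
    by (subst sum.delta) auto
  also have "\<dots> = ?Z $$ (i, j)"
    using i j assms by (auto simp: bracket_def)
  finally show "(?X * ?Y) $$ (i, j) = ?Z $$ (i, j)" .
qed (auto simp: bracket_def)

lemma bracket_empty: "m < k \<Longrightarrow> bracket n d k m = 0\<^sub>m n n"
  by (rule eq_matI) (auto simp: bracket_def)

lemma SUT_mult_closed:
  assumes "x \<in> SUT n" "y \<in> SUT n"
  shows "x * y \<in> (SUT n :: 'a::semiring_1 mat set)"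
proof -
  have [simp]: "bracket n d k m \<in> carrier_mat n n" for d k m by (simp add: bracket_def)
  have carr: "z \<in> carrier_mat n n" if "z \<in> SUT n" for z :: "'a mat"
    using that by (auto simp: SUT_def)
  show ?thesis
  proof (cases "x = 0\<^sub>m n n \<or> y = 0\<^sub>m n n")
    case True
    then show ?thesis using carr[OF assms(1)] carr[OF assms(2)] by (auto simp: SUT_def)
  next
    case False
    then obtain d k m d' k' m' where x: "x = bracket n d k m" "1 \<le> d" "1 \<le> k" "m \<le> int n - d"
      and y: "y = bracket n d' k' m'" "1 \<le> d'" "m' \<le> int n - d'"
      using assms by (auto simp: SUT_def)
    have xy: "x * y = bracket n (d + d') (max k (k' - d)) (min m (m' - d))"
      using x y by (simp add: bracket_mult)
    show ?thesis
    proof (cases "max k (k' - d) \<le> min m (m' - d)")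
      case True
      moreover have "1 \<le> d + d'" "1 \<le> max k (k' - d)" "min m (m' - d) \<le> int n - (d + d')"
        using x y by auto
      ultimately show ?thesis unfolding xy SUT_def by blast
    next
      case False
      then show ?thesis unfolding xy SUT_def by (subst bracket_empty) auto
    qed
  qed
qed

end

theory Submission
  imports Defs
begin

text \<open>
  Every product of two elements of \<^term>\<open>SUT n\<close> vanishes on the first superdiagonal, while the
  elements of \<^term>\<open>SUT_gens n\<close> do not. So the latter are irreducible and lie in every generating
  set. Conversely, the powers of one generator already run through brackets of every degree.
\<close>

text \<open>Consider a word over \<open>B\<close> with value \<open>a\<close>. If it has one letter,
  that letter is \<open>a\<close>. Otherwise splitting off the last letter writes \<open>a\<close>
  as a product of two elements of \<open>S\<close>, which \<open>irred\<close> excludes.\<close>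

lemma generating_irreducible_mem:
  assumes closed: "\<And>x y. x \<in> S \<Longrightarrow> y \<in> S \<Longrightarrow> f x y \<in> S"
    and irred: "\<And>x y. x \<in> S \<Longrightarrow> y \<in> S \<Longrightarrow> f x y \<noteq> a"
    and gen: "generates f S B" and "a \<in> S"
  shows "a \<in> B"
proof -
  obtain b bs where bs: "set (b # bs) \<subseteq> B" "a = foldl f b bs"
    using gen \<open>a \<in> S\<close> unfolding generates_def by blast
  have S: "set (b # bs) \<subseteq> S" using bs gen unfolding generates_def by blast
  show ?thesis
  proof (cases bs rule: rev_cases)
    case Nil
    then show ?thesis using bs by simp
  next
    case (snoc cs c)
    have fold: "set cs \<subseteq> S \<Longrightarrow> foldl f b cs \<in> S" for cs
      using S closed by (induction cs rule: rev_induct) auto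
    show ?thesis using irred[of "foldl f b cs" c] fold[of cs] S bs snoc by simp
  qed
qed

text \<open>Reduces minimality and rank to one inclusion: a proper subset of \<open>A\<close> cannot
  contain \<open>A\<close>, and any finite competitor contains \<open>A\<close> and so has at least
  as many elements.\<close>

lemma least_generating_set:
  assumes gen: "generates f S A" and "finite A"
    and least: "\<And>B. generates f S B \<Longrightarrow> A \<subseteq> B"
  shows "minimal_generating_set f S A" and "semigroup_rank f S = card A"
proof -
  show "minimal_generating_set f S A"
    using gen least unfolding minimal_generating_set_def by blast
  show "semigroup_rank f S = card A"
    unfolding semigroup_rank_def
    by (rule Least_equality) (use assms card_mono in blast)+
qed

text \<open>Identifies powers with words in a single letter. The exponent is a successor because the
  words in \<open>generates\<close> are nonempty.\<close>

lemma pow_mat_eq_foldl: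
  assumes "a \<in> carrier_mat n n"
  shows "a ^\<^sub>m Suc p = foldl (*) a (replicate p a)"
proof (induction p)
  case 0
  then show ?case using assms by simp
next
  case (Suc p)
  have "foldl (*) a (replicate (Suc p) a) = foldl (*) a (replicate p a) * a"
    by (simp flip: replicate_append_same)
  then show ?case using Suc by simp
qed

lemma bracket_carrier [simp]: "bracket n d k m \<in> carrier_mat n n"
  by (simp add: bracket_def)

lemma bracket_index:
  assumes "i < n" "j < n"
  shows "bracket n d k m $$ (i, j) =
    (if k \<le> int i + 1 \<and> int i + 1 \<le> m \<and> int j - int i = d then 1 else 0)"
  using assms by (simp add: bracket_def)

lemma SUT_gens_nonzero_superdiag:
  assumes "a \<in> (SUT_gens n :: 'a::semiring_1 mat set)"
  obtains i where "Suc i < n" "a $$ (i, Suc i) \<noteq> 0"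
proof -
  obtain k m where km: "a = bracket n 1 k m" "1 \<le> k" "k \<le> m" "m \<le> int n - 1"
    using assms unfolding SUT_gens_def by blast
  \<comment> \<open>Row \<open>k\<close> counted from 1 has index \<open>k - 1\<close>; the bound on
    \<open>m\<close> leaves room for the column to its right.\<close>
  then show ?thesis by (intro that[of "nat (k - 1)"]) (simp_all add: bracket_index)
qed

lemma SUT_mult_superdiag:
  assumes "x \<in> SUT n" "y \<in> (SUT n :: 'a::semiring_1 mat set)" and i: "Suc i < n"
  shows "(x * y) $$ (i, Suc i) = 0"
proof -
  have repr: "\<exists>d k m. z = bracket n d k m \<and> 1 \<le> d \<and> m \<le> int n - d"
    if "z \<in> SUT n" for z :: "'a mat"
  proof (cases "z = 0\<^sub>m n n")
    case True
    \<comment> \<open>An empty row range makes the zero matrix a bracket of degree 1 too, so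
      \<open>bracket_mult\<close> applies to all factors alike.\<close>
    then have "z = bracket n 1 0 (-1)" by (simp add: bracket_empty)
    then show ?thesis using i by (intro exI[of _ 1] exI[of _ 0] exI[of _ "-1"]) simp
  next
    case False
    then show ?thesis using that unfolding SUT_def by blast
  qed
  obtain d k m d' k' m' where "x = bracket n d k m" "1 \<le> d" "m \<le> int n - d"
    "y = bracket n d' k' m'" "1 \<le> d'"
    using repr[OF assms(1)] repr[OF assms(2)] by blast
  \<comment> \<open>The product is a bracket of degree \<open>d + d'\<close>, at least 2, so its
    entries on the first superdiagonal vanish.\<close>
  then show ?thesis using i by (simp add: bracket_mult bracket_index)
qed

lemma SUT_gens_subset_SUT: "SUT_gens n \<subseteq> SUT n"
  unfolding SUT_gens_def SUT_def by force

lemma SUT_gens_subset_generating: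
  assumes "generates (*) (SUT n) B"
  shows "SUT_gens n \<subseteq> (B :: 'a::semiring_1 mat set)"
proof
  fix a :: "'a mat" assume a: "a \<in> SUT_gens n"
  show "a \<in> B"
  proof (rule generating_irreducible_mem[OF _ _ assms])
    show "x * y \<noteq> a" if "x \<in> SUT n" "y \<in> SUT n" for x y
      using SUT_gens_nonzero_superdiag[OF a] SUT_mult_superdiag[OF that] by metis
  qed (use a SUT_gens_subset_SUT SUT_mult_closed in auto)
qed

text \<open>Each further factor raises the degree by one. By \<open>bracket_mult\<close> it keeps
  the first row \<open>k\<close> and removes the last one, so the power is zero as soon as
  \<open>m - int p < k\<close>.\<close>

lemma bracket_pow:
  assumes "m \<le> int n - 1"
  shows "bracket n 1 k m ^\<^sub>m Suc p = (bracket n (int p + 1) k (m - int p) :: 'a::semiring_1 mat)"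
proof (induction p)
  case 0
  then show ?case using left_mult_one_mat[OF bracket_carrier] by (simp add: bracket_def)
next
  case (Suc p)
  have "bracket n 1 k m ^\<^sub>m Suc (Suc p) = (bracket n 1 k m ^\<^sub>m Suc p) * (bracket n 1 k m :: 'a mat)"
    by simp
  also have "\<dots> = bracket n (int p + 1) k (m - int p) * bracket n 1 k m"
    by (simp only: Suc)
  also have "\<dots> = bracket n (int p + 1 + 1) (max k (k - (int p + 1))) (min (m - int p) (m - (int p + 1)))"
    using assms by (intro bracket_mult) auto
  also have "\<dots> = bracket n (int (Suc p) + 1) k (m - int (Suc p))"
    by (simp add: max_def min_def algebra_simps)
  finally show ?case .
qed

text \<open>The \<open>d\<close>-th power loses \<open>d - 1\<close> rows at the end, so the base
  starts with that many more.\<close>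

lemma bracket_eq_pow:
  assumes "1 \<le> d" "m \<le> int n - d"
  shows "bracket n d k m = (bracket n 1 k (m + d - 1) ^\<^sub>m nat d :: 'a::semiring_1 mat)"
proof -
  have "nat d = Suc (nat (d - 1))" using assms by linarith
  then show ?thesis using assms bracket_pow[of "m + d - 1" n k "nat (d - 1)", where 'a = 'a] by simp
qed

lemma zero_eq_bracket_square:
  assumes "n \<ge> 2"
  shows "(0\<^sub>m n n :: 'a::semiring_1 mat) = bracket n 1 1 1 ^\<^sub>m 2"
  \<comment> \<open>The square has row range from 1 to 0, which is empty.\<close>
  using bracket_pow[of 1 n 1 1, where 'a = 'a] assms by (simp add: bracket_empty numeral_2_eq_2)

lemma SUT_is_pow:
  assumes "n \<ge> 2" "x \<in> (SUT n :: 'a::semiring_1 mat set)"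
  shows "\<exists>a \<in> SUT_gens n. \<exists>p \<ge> 1. x = a ^\<^sub>m p"
proof (cases "x = 0\<^sub>m n n")
  case True
  moreover have "bracket n 1 1 1 \<in> (SUT_gens n :: 'a mat set)"
    using assms unfolding SUT_gens_def by force
  ultimately show ?thesis using zero_eq_bracket_square[OF assms(1)] one_le_numeral by blast
next
  case False
  then obtain d k m where x: "x = bracket n d k m" "1 \<le> d" "1 \<le> k" "k \<le> m" "m \<le> int n - d"
    using assms unfolding SUT_def by blast
  have "bracket n 1 k (m + d - 1) \<in> (SUT_gens n :: 'a mat set)"
    using x unfolding SUT_gens_def by force
  moreover have "1 \<le> nat d" using x by linarith
  ultimately show ?thesis using bracket_eq_pow x by blast
qed

lemma generates_SUT:
  assumes "n \<ge> 2"
  shows "generates (*) (SUT n) (SUT_gens n :: 'a::semiring_1 mat set)"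
  unfolding generates_def
proof (intro conjI ballI SUT_gens_subset_SUT)
  fix x :: "'a mat" assume "x \<in> SUT n"
  then obtain a p where a: "a \<in> SUT_gens n" "p \<ge> 1" "x = a ^\<^sub>m p"
    using SUT_is_pow[OF assms] by blast
  then obtain q where q: "p = Suc q" by (cases p) auto
  have "a \<in> carrier_mat n n" using a(1) by (auto simp: SUT_gens_def)
  then have "x = foldl (*) a (replicate q a)" using a q by (simp only: pow_mat_eq_foldl)
  then show "\<exists>a as. set (a # as) \<subseteq> SUT_gens n \<and> x = foldl (*) a as"
    using a(1) by (intro exI[of _ a] exI[of _ "replicate q a"]) auto
qed

text \<open>The ones on the first superdiagonal mark the rows from \<open>k\<close> to
  \<open>m\<close>. Both intervals are nonempty, so testing the four endpoints for membership
  determines them.\<close>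

lemma bracket_1_inject:
  assumes eq: "bracket n 1 k m = (bracket n 1 k' m' :: 'a::semiring_1 mat)"
    and "1 \<le> k" "k \<le> m" "m \<le> int n - 1" "1 \<le> k'" "k' \<le> m'" "m' \<le> int n - 1"
  shows "k = k' \<and> m = m'"
proof -
  have iff: "k \<le> r \<and> r \<le> m \<longleftrightarrow> k' \<le> r \<and> r \<le> m'" if "1 \<le> r" "r \<le> int n - 1" for r
  proof -
    define i where "i = nat (r - 1)"
    have i: "Suc i < n" "int i + 1 = r" using that by (auto simp: i_def)
    have "(bracket n 1 k m :: 'a mat) $$ (i, Suc i) = (bracket n 1 k' m' :: 'a mat) $$ (i, Suc i)"
      using eq by simp
    then show ?thesis using i by (auto simp: bracket_index split: if_splits)
  qed
  show ?thesis using iff[of k] iff[of m] iff[of k'] iff[of m'] assms(2-) by linarith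
qed

text \<open>With the last row \<open>m\<close> as outer index there are exactly \<open>m\<close>
  choices of \<open>k\<close>, so the cardinality becomes the triangular sum over \<open>m\<close>
  from 1 to \<open>n - 1\<close>.\<close>

lemma SUT_gens_bij_betw:
  "bij_betw (\<lambda>(m, k). bracket n 1 (int k) (int m)) (SIGMA m:{1..n - 1}. {1..m})
     (SUT_gens n :: 'a::semiring_1 mat set)"
  unfolding bij_betw_def
proof
  show "inj_on (\<lambda>(m, k). bracket n 1 (int k) (int m) :: 'a mat) (SIGMA m:{1..n - 1}. {1..m})"
    by (rule inj_onI) (auto dest!: bracket_1_inject)
  show "(\<lambda>(m, k). bracket n 1 (int k) (int m)) ` (SIGMA m:{1..n - 1}. {1..m}) =
      (SUT_gens n :: 'a mat set)" (is "?f ` ?I = _")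
  proof
    show "?f ` ?I \<subseteq> SUT_gens n" unfolding SUT_gens_def by force
    show "SUT_gens n \<subseteq> ?f ` ?I"
    proof
      fix a :: "'a mat" assume "a \<in> SUT_gens n"
      then obtain k m where "a = bracket n 1 k m" "1 \<le> k" "k \<le> m" "m \<le> int n - 1"
        unfolding SUT_gens_def by blast
      then have "a = ?f (nat m, nat k)" "(nat m, nat k) \<in> ?I" by auto
      then show "a \<in> ?f ` ?I" by (rule image_eqI)
    qed
  qed
qed

lemma finite_SUT_gens: "finite (SUT_gens n :: 'a::semiring_1 mat set)"
  using bij_betw_finite[OF SUT_gens_bij_betw[of n, where 'a = 'a]] by simp

lemma card_SUT_gens:
  assumes "n \<ge> 1"
  shows "real (card (SUT_gens n :: 'a::semiring_1 mat set)) = 1 / 2 * real n * (real n - 1)"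
proof -
  have "card (SUT_gens n :: 'a mat set) = (\<Sum>m = 1..n - 1. m)"
    using bij_betw_same_card[OF SUT_gens_bij_betw[of n, where 'a = 'a]] by simp
  moreover have "2 * (\<Sum>m = 1..n - 1. real m) = real (n - 1) * (real (n - 1) + 1)"
    using double_gauss_sum_from_Suc_0[of "n - 1", where 'a = real] by simp
  ultimately show ?thesis using assms by (simp add: of_nat_diff algebra_simps)
qed

theorem theorem15:
  fixes n :: nat
  assumes "n \<ge> 2"
  shows "minimal_generating_set (*) (SUT n) (SUT_gens n :: 'a::semiring_1 mat set) \<and>
    semigroup_rank (*) (SUT n :: 'a mat set) = card (SUT_gens n :: 'a mat set) \<and>
    real (card (SUT_gens n :: 'a mat set)) = 1 / 2 * real n * (real n - 1) \<and>
    (\<forall>x \<in> (SUT n :: 'a mat set). \<exists>a \<in> SUT_gens n. \<exists>p \<ge> 1. x = a ^\<^sub>m p) \<and>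
    bracket n 1 1 1 \<in> (SUT_gens n :: 'a mat set) \<and>
    (0\<^sub>m n n :: 'a mat) = bracket n 1 1 1 ^\<^sub>m 2 \<and>
    (\<forall>x \<in> SUT n - {0\<^sub>m n n :: 'a mat}. \<forall>d k m.
       1 \<le> d \<and> 1 \<le> k \<and> k \<le> m \<and> m \<le> int n - d \<and> x = bracket n d k m \<longrightarrow>
         bracket n 1 k (m + d - 1) \<in> (SUT_gens n :: 'a mat set) \<and>
         x = bracket n 1 k (m + d - 1) ^\<^sub>m nat d)"
proof -
  have "bracket n 1 k (m + d - 1) \<in> (SUT_gens n :: 'a mat set)"
    if "1 \<le> d" "1 \<le> k" "k \<le> m" "m \<le> int n - d" for d k m
    using that unfolding SUT_gens_def by force
  \<comment> \<open>The instance \<open>d = k = m = 1\<close> is the membership of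
    \<open>bracket n 1 1 1\<close>, whose square is zero.\<close>
  from this[of 1 1 1] this show ?thesis
    using assms least_generating_set[OF generates_SUT finite_SUT_gens SUT_gens_subset_generating]
      card_SUT_gens[of n] SUT_is_pow[of n] zero_eq_bracket_square[of n] bracket_eq_pow
    by (intro conjI ballI allI impI) auto
qed

end
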